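(* Let $(S,M,T)$ be a triangulated bordered unpunctured surface of genus $0$ and let $\Lambda_1,\Lambda_2$ be surface algebras of type $(S,M,T)$ given by admissible cuts $\chi_1,\chi_2$. Then $\tilde\Lambda_1$ and $\tilde\Lambda_2$ are graded equivalent via the identity if and only if $(\chi_1,\chi_2)$ is equi-distributed.
   Context: $S$ is a connected oriented Riemann surface with boundary and no punctures, $M\subset\partial S$ a finite set of marked points with at least one on each boundary component (if $S$ is a disc, $|M|\ge5$). A triangulation $T$ is a maximal set of pairwise non-crossing arcs (isotopy classes of simple curves between marked points, interior avoiding $M$ and $\partial S$, not cutting out a monogon or digon); it cuts $S$ into triangles; a triangle is internal if none of its sides is a boundary segment. The quiver $Q_T$ has a vertex $i$ per arc $\tau_i$ and an arrow $i\to j$ for each triangle in which $\tau_i,\tau_j$ are sides with $\tau_j$ following $\tau_i$ counterclockwise. $\Lambda_T=kQ_T/I_T$ with $I_T$ generated by the length-two subpaths of the oriented 3-cycles coming from internal triangles. An admissible cut $\chi$ selects one vertex (marked point) $v$ in each internal triangle; the two sides at $v$ determine an arrow of that 3-cycle (the local cut); $\chi$ is identified with this set of arrows, and the surface algebra is $\Lambda=kQ_T/\langle I_T\cup\chi\rangle$. $\tilde\Lambda_i$ denotes $\Lambda_T$ graded by the weight $w_i(\alpha)=1$ if $\alpha\in\chi_i$, $w_i(\alpha)=0$ otherwise. $\tilde\Lambda_1,\tilde\Lambda_2$ are graded equivalent via the identity if there is a function $r\colon (Q_T)_0\to\mathbb{Z}$ with $w_2(\alpha)=w_1(\alpha)+r(s(\alpha))-r(t(\alpha))$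 for every arrow $\alpha$ of $Q_T$ (i.e. a graded equivalence induced by the identity on $Q_T$). $(\chi_1,\chi_2)$ is equi-distributed if for every boundary component $B$ of $S$ the number of local cuts of $\chi_1$ whose selected marked point lies on $B$ equals the corresponding number for $\chi_2$. *)

theory Defs
  imports Main
begin

text \<open>
Combinatorial model of a triangulated bordered unpunctured oriented surface (S,M,T).
The surface is obtained by gluing a finite set of oriented triangles TR along
sides.  A side (or corner) of triangle t is a pair (t,k) with k in {0,1,2};
the three corners v0,v1,v2 of a triangle are numbered counterclockwise and
side k runs from corner k to corner k+1 (mod 3), so side k+1 follows side k
counterclockwise.  The partial map gl pairs sides: gl d = Some e means that
side d is glued (orientation reversingly) to side e; such a pair is an arc
of the triangulation.  An unglued side is a boundary segment.  Marked points
are the classes of corners identified by the gluing.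
\<close>

definition sides :: "'t set \<Rightarrow> ('t \<times> nat) set" where
  "sides TR = TR \<times> {0,1,2}"

definition glued :: "('t \<times> nat \<Rightarrow> ('t \<times> nat) option) \<Rightarrow> 't \<times> nat \<Rightarrow> bool" where
  "glued gl d \<longleftrightarrow> gl d \<noteq> None"

text \<open>Rotation around a marked point: gluing side (t,k) to (t',k') identifies
corner k of t with corner k'+1 of t'.\<close>
definition rot_rel :: "('t \<times> nat \<Rightarrow> ('t \<times> nat) option) \<Rightarrow> (('t \<times> nat) \<times> ('t \<times> nat)) set" where
  "rot_rel gl = {((t,k),(t',(k'+1) mod 3)) | t k t' k'. gl (t,k) = Some (t',k')}"

definition adj_rel :: "('t \<times> nat \<Rightarrow> ('t \<times> nat) option) \<Rightarrow> ('t \<times> 't) set" where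
  "adj_rel gl = {(t,t') | t k t' k'. gl (t,k) = Some (t',k')}"

text \<open>Well-formed gluing data = a connected oriented triangulated surface with
boundary in which every marked point lies on the boundary (acyclicity of the
rotation: no interior vertex, i.e. no punctures).\<close>
definition triangulated_surface ::
  "'t set \<Rightarrow> ('t \<times> nat \<Rightarrow> ('t \<times> nat) option) \<Rightarrow> bool" where
  "triangulated_surface TR gl \<longleftrightarrow>
     finite TR \<and> TR \<noteq> {} \<and>
     (\<forall>d e. gl d = Some e \<longrightarrow> d \<in> sides TR \<and> e \<in> sides TR \<and> e \<noteq> d \<and> gl e = Some d) \<and>
     (\<forall>t\<in>TR. \<forall>t'\<in>TR. (t,t') \<in> (adj_rel gl)\<^sup>*) \<and>
     acyclic (rot_rel gl)"

definition vrel :: "'t set \<Rightarrow> ('t \<times> nat \<Rightarrow> ('t \<times> nat) option) \<Rightarrow> (('t \<times> nat) \<times> ('t \<times> nat)) set" where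
  "vrel TR gl = (rot_rel gl \<union> (rot_rel gl)\<inverse>)\<^sup>* \<inter> (sides TR \<times> sides TR)"

text \<open>The marked point at a corner, and the set M of marked points.\<close>
definition vertex_of :: "'t set \<Rightarrow> ('t \<times> nat \<Rightarrow> ('t \<times> nat) option) \<Rightarrow> 't \<times> nat \<Rightarrow> ('t \<times> nat) set" where
  "vertex_of TR gl c = vrel TR gl `` {c}"

definition marked_points :: "'t set \<Rightarrow> ('t \<times> nat \<Rightarrow> ('t \<times> nat) option) \<Rightarrow> ('t \<times> nat) set set" where
  "marked_points TR gl = sides TR // vrel TR gl"

text \<open>Arcs of the triangulation (= vertices of Q_T) and boundary segments.\<close>
definition arc_of :: "('t \<times> nat \<Rightarrow> ('t \<times> nat) option) \<Rightarrow> 't \<times> nat \<Rightarrow> ('t \<times> nat) set" where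
  "arc_of gl d = {d, the (gl d)}"

definition arcs :: "('t \<times> nat \<Rightarrow> ('t \<times> nat) option) \<Rightarrow> ('t \<times> nat) set set" where
  "arcs gl = {{d, e} | d e. gl d = Some e}"

definition bsegs :: "'t set \<Rightarrow> ('t \<times> nat \<Rightarrow> ('t \<times> nat) option) \<Rightarrow> ('t \<times> nat) set" where
  "bsegs TR gl = {d \<in> sides TR. gl d = None}"

text \<open>Boundary components: classes of marked points connected by boundary segments.\<close>
definition brel :: "'t set \<Rightarrow> ('t \<times> nat \<Rightarrow> ('t \<times> nat) option) \<Rightarrow> (('t \<times> nat) set \<times> ('t \<times> nat) set) set" where
  "brel TR gl =
     (let E = {(vertex_of TR gl (t,k), vertex_of TR gl (t,(k+1) mod 3)) | t k. (t,k) \<in> bsegs TR gl}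
      in (E \<union> E\<inverse>)\<^sup>* \<inter> (marked_points TR gl \<times> marked_points TR gl))"

definition boundary_components :: "'t set \<Rightarrow> ('t \<times> nat \<Rightarrow> ('t \<times> nat) option) \<Rightarrow> ('t \<times> nat) set set set" where
  "boundary_components TR gl = marked_points TR gl // brel TR gl"

text \<open>Euler characteristic V - E + F and genus (2 - b - chi)/2.\<close>
definition euler_char :: "'t set \<Rightarrow> ('t \<times> nat \<Rightarrow> ('t \<times> nat) option) \<Rightarrow> int" where
  "euler_char TR gl = int (card (marked_points TR gl))
      - int (card (arcs gl) + card (bsegs TR gl)) + int (card TR)"

definition genus :: "'t set \<Rightarrow> ('t \<times> nat \<Rightarrow> ('t \<times> nat) option) \<Rightarrow> int" where
  "genus TR gl = (2 - int (card (boundary_components TR gl)) - euler_char TR gl) div 2"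

text \<open>Standing assumption: if S is a disc then |M| \<ge> 5.\<close>
definition standing_assms :: "'t set \<Rightarrow> ('t \<times> nat \<Rightarrow> ('t \<times> nat) option) \<Rightarrow> bool" where
  "standing_assms TR gl \<longleftrightarrow> triangulated_surface TR gl \<and>
     ((genus TR gl = 0 \<and> card (boundary_components TR gl) = 1) \<longrightarrow> card (marked_points TR gl) \<ge> 5)"

definition internal :: "('t \<times> nat \<Rightarrow> ('t \<times> nat) option) \<Rightarrow> 't \<Rightarrow> bool" where
  "internal gl t \<longleftrightarrow> glued gl (t,0) \<and> glued gl (t,1) \<and> glued gl (t,2)"

text \<open>Arrows of Q_T: arrow (t,k) goes from the arc on side k to the arc on side k+1
(which follows side k counterclockwise), both sides being arcs.\<close>
definition arrows :: "'t set \<Rightarrow> ('t \<times> nat \<Rightarrow> ('t \<times> nat) option) \<Rightarrow> ('t \<times> nat) set" where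
  "arrows TR gl = {(t,k). t \<in> TR \<and> k < 3 \<and> glued gl (t,k) \<and> glued gl (t,(k+1) mod 3)}"

definition arr_src :: "('t \<times> nat \<Rightarrow> ('t \<times> nat) option) \<Rightarrow> 't \<times> nat \<Rightarrow> ('t \<times> nat) set" where
  "arr_src gl a = arc_of gl a"

definition arr_tgt :: "('t \<times> nat \<Rightarrow> ('t \<times> nat) option) \<Rightarrow> 't \<times> nat \<Rightarrow> ('t \<times> nat) set" where
  "arr_tgt gl a = arc_of gl (fst a, (snd a + 1) mod 3)"

text \<open>An admissible cut selects a corner chi t in {0,1,2} of every internal
triangle t.  The two sides at corner c are side (c+2) mod 3 and side c; the
local cut is the arrow (t,(c+2) mod 3) between them.\<close>
definition admissible_cut :: "'t set \<Rightarrow> ('t \<times> nat \<Rightarrow> ('t \<times> nat) option) \<Rightarrow> ('t \<Rightarrow> nat) \<Rightarrow> bool" where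
  "admissible_cut TR gl chi \<longleftrightarrow> (\<forall>t\<in>TR. internal gl t \<longrightarrow> chi t < 3)"

definition cut_weight :: "('t \<times> nat \<Rightarrow> ('t \<times> nat) option) \<Rightarrow> ('t \<Rightarrow> nat) \<Rightarrow> 't \<times> nat \<Rightarrow> int" where
  "cut_weight gl chi a = (if internal gl (fst a) \<and> snd a = (chi (fst a) + 2) mod 3 then 1 else 0)"

definition graded_equiv_id ::
  "'t set \<Rightarrow> ('t \<times> nat \<Rightarrow> ('t \<times> nat) option) \<Rightarrow> ('t \<Rightarrow> nat) \<Rightarrow> ('t \<Rightarrow> nat) \<Rightarrow> bool" where
  "graded_equiv_id TR gl chi1 chi2 \<longleftrightarrow>
     (\<exists>r :: ('t \<times> nat) set \<Rightarrow> int. \<forall>a\<in>arrows TR gl.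
        cut_weight gl chi2 a = cut_weight gl chi1 a + r (arr_src gl a) - r (arr_tgt gl a))"

definition equi_distributed ::
  "'t set \<Rightarrow> ('t \<times> nat \<Rightarrow> ('t \<times> nat) option) \<Rightarrow> ('t \<Rightarrow> nat) \<Rightarrow> ('t \<Rightarrow> nat) \<Rightarrow> bool" where
  "equi_distributed TR gl chi1 chi2 \<longleftrightarrow>
     (\<forall>B\<in>boundary_components TR gl.
        card {t\<in>TR. internal gl t \<and> vertex_of TR gl (t, chi1 t) \<in> B}
      = card {t\<in>TR. internal gl t \<and> vertex_of TR gl (t, chi2 t) \<in> B})"

end

theory Submission
  imports Defs "HOL-Combinatorics.Orbits"
begin

text \<open>
  Let \<open>v\<close> be the difference of the two weights, seen as a function on corners; it sums to zero over
  each triangle. A grading change \<open>r\<close> extends from the arcs to all sides, with constant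
  value on each non-internal triangle, so that \<open>v\<close> at a corner is the difference of \<open>r\<close> on the two
  sides meeting there. Summing over the corners on one boundary component, the values of \<open>r\<close>
  cancel in pairs, so the cuts are equi-distributed.

  Conversely, integrate \<open>v\<close> separately on each triangle, and fix the constants along a spanning tree
  of the dual graph so that the primitives agree across the arcs of the tree. The jump across the
  other arcs is a flow on the graph whose nodes are the boundary components, and it is
  divergence-free by equi-distribution. The arcs outside the tree connect all boundary components,
  and in genus 0 Euler's formula leaves one arc less than there are components. So they form a tree,
  on which every divergence-free flow vanishes.
\<close>

section \<open>Parity of a permutation and its orbits\<close>

text \<open>Composing with this transposition cuts \<open>a\<close> out of its cycle: the preimage
  of \<open>a\<close> is sent straight to \<open>p a\<close>, and \<open>a\<close> becomes
  fixed.\<close>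

lemma orbit_skip:
  assumes p: "p permutes insert a D" and a: "a \<notin> D" and ne: "p a \<noteq> a" and x: "x \<in> D"
  shows "orbit (transpose a (p a) \<circ> p) x = orbit p x - {a}"
proof -
  define q where "q = transpose a (p a) \<circ> p"
  have inj: "p y = p z \<longleftrightarrow> y = z" for y z
    using p by (meson injD permutes_inj)
  have qa: "q y = a \<longleftrightarrow> y = a" for y
    unfolding q_def using inj by (auto simp: transpose_def split: if_splits)
  have q: "q y = (if p y = a then p a else p y)" if "y \<noteq> a" for y
    using that inj unfolding q_def by (auto simp: transpose_def)
  have xa: "x \<noteq> a" using x a by auto
  have "y \<in> orbit p x \<and> y \<noteq> a" if "y \<in> orbit q x" for y
    using that
  proof induction
    case base
    then show ?case using q[OF xa] qa[of x] xa by (metis orbit.base orbit.step)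
  next
    case (step y)
    then show ?case using q[of y] qa[of y] by (metis orbit.step)
  qed
  moreover have "(y = a \<longrightarrow> p a \<in> orbit q x) \<and> (y \<noteq> a \<longrightarrow> y \<in> orbit q x)" if "y \<in> orbit p x" for y
    using that
  proof induction
    case base
    then show ?case using q[OF xa] by (metis orbit.base)
  next
    case (step y)
    then show ?case using q[of y] ne by (metis orbit.step)
  qed
  ultimately show ?thesis unfolding q_def[symmetric] by blast
qed

lemma orbit_eq_iff_mem:
  assumes "finite D" "p permutes D"
  shows "orbit p x = orbit p y \<longleftrightarrow> y \<in> orbit p x"
proof -
  have perm: "permutation p" using assms by (auto simp: permutation_permutes)
  show ?thesis
    using permutation_self_in_orbit[OF perm] orbit_swap[of _ p] orbit_trans[of _ p] by blast
qed

text \<open>The sign is (-1)^(n - c) for c cycles on n points. Removing a fixed point loses one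
  point and one cycle; cutting \<open>a\<close> out of a longer cycle flips the sign and loses one
  point but no cycle.\<close>

lemma evenperm_iff_orbits:
  assumes "finite D" "p permutes D"
  shows "evenperm p \<longleftrightarrow> even (card D + card (orbit p ` D))"
  using assms
proof (induction D arbitrary: p rule: finite_induct)
  case empty
  then show ?case by (simp add: permutes_empty)
next
  case (insert a D)
  note p = \<open>p permutes insert a D\<close>
  have perm: "permutation p" using p insert.hyps by (metis finite_insert permutation_permutes)
  have fin: "finite (insert a D)" using insert.hyps by simp
  show ?case
  proof (cases "p a = a")
    case True
    then have pD: "p permutes D" using p insert.hyps
      by (auto intro: permutes_superset)
    have "y = a" if "y \<in> orbit p a" for y
      using that by induction (use True in auto)
    then have "orbit p a = {a}" using permutation_self_in_orbit[OF perm] by blast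
    moreover have "{a} \<notin> orbit p ` D"
      using insert.hyps permutation_self_in_orbit[OF perm] by (metis imageE singletonD)
    ultimately have "card (orbit p ` insert a D) = Suc (card (orbit p ` D))"
      using insert.hyps by simp
    then show ?thesis using insert.IH[OF pD] insert.hyps by simp
  next
    case False
    define q where "q = transpose a (p a) \<circ> p"
    have qD: "q permutes D" unfolding q_def using p by (rule permutes_insert_lemma)
    have ev: "evenperm q \<longleftrightarrow> \<not> evenperm p"
      unfolding q_def using False perm
      by (subst evenperm_comp) (auto simp: evenperm_swap permutation_swap_id)
    have paD: "p a \<in> D" using p False by (metis insertE insertI1 permutes_in_image)
    have "orbit p a = orbit p (p a)"
      by (simp add: orbit_eq_iff_mem[OF fin p] orbit.base)
    then have 1: "orbit p ` insert a D = orbit p ` D" using paD by auto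
    have 2: "orbit q ` D = (\<lambda>X. X - {a}) ` (orbit p ` D)"
      unfolding image_image q_def using orbit_skip[OF p insert.hyps(2) False] by simp
    have "inj_on (\<lambda>X. X - {a}) (orbit p ` D)"
    proof (rule inj_onI, clarify)
      fix x y assume xy: "x \<in> D" "y \<in> D" "orbit p x - {a} = orbit p y - {a}"
      have "y \<in> orbit p y - {a}" using permutation_self_in_orbit[OF perm] xy insert.hyps by blast
      then show "orbit p x = orbit p y" unfolding orbit_eq_iff_mem[OF fin p] using xy by blast
    qed
    then have "card (orbit q ` D) = card (orbit p ` insert a D)"
      unfolding 1 2 by (rule card_image)
    then have "\<not> evenperm p \<longleftrightarrow> even (card D + card (orbit p ` insert a D))"
      using insert.IH[OF qD] ev by metis
    then show ?thesis
      unfolding card_insert_disjoint[OF insert.hyps] add_Suc even_Suc by blast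
  qed
qed

text \<open>Used to count orbits by means of any other invariant that separates the same
  points.\<close>

lemma card_image_eq_of_fibres:
  assumes "\<And>x y. x \<in> D \<Longrightarrow> y \<in> D \<Longrightarrow> f x = f y \<longleftrightarrow> g x = g y"
  shows "card (f ` D) = card (g ` D)"
proof -
  have "bij_betw (\<lambda>z. g (SOME x. x \<in> D \<and> f x = z)) (f ` D) (g ` D)"
  proof -
    have *: "g (SOME y. y \<in> D \<and> f y = f x) = g x" if "x \<in> D" for x
    proof -
      have "(SOME y. y \<in> D \<and> f y = f x) \<in> D \<and> f (SOME y. y \<in> D \<and> f y = f x) = f x"
        by (rule someI[of _ x]) (use that in auto)
      then show ?thesis using assms that by blast
    qed
    show ?thesis
      unfolding bij_betw_def inj_on_def image_image using * assms by auto
  qed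
  then show ?thesis by (rule bij_betw_same_card)
qed

section \<open>Equivalence closures and graphs with few edges\<close>

lemma equiv_rtrancl_sym_restrict: "equiv A ((E \<union> E\<inverse>)\<^sup>* \<inter> (A \<times> A))"
proof (rule equivI)
  have "sym ((E \<union> E\<inverse>)\<^sup>*)" by (intro sym_rtrancl sym_Un_converse)
  then show "sym ((E \<union> E\<inverse>)\<^sup>* \<inter> (A \<times> A))" by (auto simp: sym_def)
  show "trans ((E \<union> E\<inverse>)\<^sup>* \<inter> (A \<times> A))" by (auto intro!: transI dest: rtrancl_trans)
qed (auto simp: refl_on_def)

text \<open>Each edge lowers the number of components by at most one, so at least two remain and
  \<open>a\<close> can single out a union of components. The induction contracts an edge.\<close>

lemma few_edges_disconnected:
  assumes "finite S" "finite A" "card S + 2 \<le> card A"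
  shows "\<exists>a :: 'a \<Rightarrow> bool. (\<exists>x\<in>A. a x) \<and> (\<exists>x\<in>A. \<not> a x) \<and> (\<forall>(x,y)\<in>S. a x = a y)"
  using assms
proof (induction "card S" arbitrary: S A rule: less_induct)
  case less
  show ?case
  proof (cases "S = {}")
    case True
    with less.prems have "2 \<le> card A" by simp
    then obtain B where B: "B \<subseteq> A" "card B = 2"
      by (rule obtain_subset_with_card_n)
    obtain x y where "B = {x, y}" "x \<noteq> y" using B(2) by (auto simp: card_2_iff)
    then have "x \<in> A" "y \<in> A" "x \<noteq> y" using B(1) by auto
    then show ?thesis using True by (intro exI[of _ "\<lambda>z. z = x"]) auto
  next
    case False
    then obtain x y where xy: "(x,y) \<in> S" by auto
    \<comment> \<open>\<open>f\<close> contracts the edge by merging \<open>y\<close> into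
      \<open>x\<close>.\<close>
    define f where "f z = (if z = y then x else z)" for z
    define S' where "S' = map_prod f f ` (S - {(x,y)})"
    have c: "card S' < card S"
      unfolding S'_def using xy less.prems(1)
      by (meson card_Diff1_less card_image_le finite_Diff order.strict_trans1)
    \<comment> \<open>A loop merges no vertices, so in that case none is dropped.\<close>
    define A' where "A' = (if x = y then A else A - {y})"
    have "card A \<le> card (insert y A')" using less.prems(2)
      by (intro card_mono) (auto simp: A'_def)
    also have "\<dots> \<le> Suc (card A')"
      using less.prems(2) by (simp add: A'_def card_insert_if)
    finally have "card S' + 2 \<le> card A'" using c less.prems(3) by linarith
    moreover have "finite S'" "finite A'" using less.prems by (auto simp: S'_def A'_def)
    ultimately have "\<exists>a :: 'a \<Rightarrow> bool. (\<exists>z\<in>A'. a z) \<and> (\<exists>z\<in>A'. \<not> a z) \<and> (\<forall>(z,w)\<in>S'. a z = a w)"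
      by (intro less.hyps[OF c])
    then obtain a where a: "\<exists>z\<in>A'. a z" "\<exists>z\<in>A'. \<not> a z" "\<forall>(z,w)\<in>S'. a z = a w"
      by (elim exE conjE)
    have fA: "f z = z" if "z \<in> A'" for z using that by (auto simp: f_def A'_def split: if_splits)
    have "A' \<subseteq> A" by (auto simp: A'_def)
    then have "\<exists>z\<in>A. a (f z)" "\<exists>z\<in>A. \<not> a (f z)" using a fA by (metis subsetD)+
    moreover have "a (f z) = a (f w)" if "(z, w) \<in> S" for z w
    proof (cases "(z, w) = (x, y)")
      case True
      then show ?thesis by (simp add: f_def)
    next
      case False
      then have "(f z, f w) \<in> S'" using that by (force simp: S'_def)
      then show ?thesis using a(3) by blast
    qed
    ultimately show ?thesis by (intro exI[of _ "a \<circ> f"]) auto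
  qed
qed

section \<open>Sides, corners and boundary components\<close>

locale triangulation =
  fixes TR :: "'t set" and gl :: "'t \<times> nat \<Rightarrow> ('t \<times> nat) option"
  assumes surface: "triangulated_surface TR gl"
begin

abbreviation "D \<equiv> sides TR"

text \<open>An element of \<open>D\<close> is read both as a side and as its starting corner, so
  side \<open>d\<close> runs from corner \<open>d\<close> to corner \<open>nx d\<close>. Outside
  \<open>D\<close> the value is the identity, as \<open>permutes\<close> requires.\<close>

definition nx :: "'t \<times> nat \<Rightarrow> 't \<times> nat" where
  "nx d = (if d \<in> D then (fst d, (snd d + 1) mod 3) else d)"

text \<open>Boundary segments become fixed points, which turns the partial gluing into a total
  involution.\<close>

definition mate :: "'t \<times> nat \<Rightarrow> 't \<times> nat" where
  "mate d = (case gl d of None \<Rightarrow> d | Some e \<Rightarrow> e)"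

lemma mem_D: "(t, k) \<in> D \<longleftrightarrow> t \<in> TR \<and> k < 3"
  by (auto simp: sides_def)

lemma finite_TR: "finite TR" and TR_nonempty: "TR \<noteq> {}"
  using surface by (auto simp: triangulated_surface_def)

lemma finite_D: "finite D"
  using finite_TR by (simp add: sides_def)

lemma card_D: "card D = 3 * card TR"
  by (simp add: sides_def card_cartesian_product)

lemma glD:
  assumes "gl d = Some e"
  shows "d \<in> D" "e \<in> D" "e \<noteq> d" "gl e = Some d"
  using surface assms unfolding triangulated_surface_def by blast+

lemma connected: "t \<in> TR \<Longrightarrow> t' \<in> TR \<Longrightarrow> (t, t') \<in> (adj_rel gl)\<^sup>*"
  using surface by (auto simp: triangulated_surface_def)

lemma acyclic_rot: "acyclic (rot_rel gl)"
  using surface by (simp add: triangulated_surface_def)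

lemma mate_mate [simp]: "mate (mate d) = d"
  by (cases "gl d") (use glD[of d] in \<open>auto simp: mate_def\<close>)

lemma mate_in_D [simp]: "mate d \<in> D \<longleftrightarrow> d \<in> D"
  by (cases "gl d") (use glD[of d] in \<open>auto simp: mate_def\<close>)

lemma mate_fixed_iff: "mate d = d \<longleftrightarrow> gl d = None"
  by (cases "gl d") (use glD[of d] in \<open>auto simp: mate_def\<close>)

lemma nx_in_D [simp]: "nx d \<in> D \<longleftrightarrow> d \<in> D"
  by (cases d) (auto simp: nx_def mem_D)

lemma fst_nx [simp]: "fst (nx d) = fst d"
  by (simp add: nx_def)

lemma nx_nx_nx [simp]: "nx (nx (nx d)) = d"
proof (cases "d \<in> D")
  case True
  then obtain t k where "d = (t, k)" "t \<in> TR" "k = 0 \<or> k = 1 \<or> k = 2"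
    by (cases d) (auto simp: sides_def)
  then show ?thesis by (auto simp: nx_def mem_D)
qed (simp add: nx_def)

lemma nx_neq: "d \<in> D \<Longrightarrow> nx d \<noteq> d"
  by (cases d) (auto simp: nx_def mem_D, presburger)

lemma same_triangle:
  assumes "d \<in> D" "d' \<in> D" "fst d = fst d'"
  shows "d' = d \<or> d' = nx d \<or> d' = nx (nx d)"
proof -
  obtain t k k' where "d = (t, k)" "d' = (t, k')" "t \<in> TR" "k \<in> {0,1,2}" "k' \<in> {0,1,2}"
    using assms by (cases d; cases d') (auto simp: sides_def)
  then show ?thesis by (auto simp: nx_def mem_D)
qed

lemma permutes_nx: "nx permutes D"
proof (rule bij_imp_permutes)
  have "inj_on nx D" by (metis inj_onI nx_nx_nx)
  moreover have "nx ` D = D"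
    by (metis calculation endo_inj_surj finite_D image_subsetI nx_in_D)
  ultimately show "bij_betw nx D D" by (simp add: bij_betw_def)
qed (simp add: nx_def)

lemma permutes_mate: "mate permutes D"
proof (rule bij_imp_permutes)
  have "inj_on mate D" by (metis inj_onI mate_mate)
  moreover have "mate ` D = D"
    by (metis calculation endo_inj_surj finite_D image_subsetI mate_in_D)
  ultimately show "bij_betw mate D D" by (simp add: bij_betw_def)
  show "mate d = d" if "d \<notin> D" for d
    by (cases "gl d") (use that glD(1)[of d] in \<open>auto simp: mate_def\<close>)
qed

lemma rot_rel_iff: "(c, c') \<in> rot_rel gl \<longleftrightarrow> gl c \<noteq> None \<and> c' = nx (mate c)"
proof -
  have "nx (t, k) = (t, (k + 1) mod 3)" if "gl c = Some (t, k)" for t k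
    using glD(2)[OF that] by (simp add: nx_def)
  then show ?thesis
    by (cases c; cases "gl c") (auto simp: rot_rel_def mate_def)
qed

subsection \<open>Marked points\<close>

lemma equiv_vrel: "equiv D (vrel TR gl)"
  unfolding vrel_def by (rule equiv_rtrancl_sym_restrict)

lemma marked_points_eq: "marked_points TR gl = vertex_of TR gl ` D"
  by (auto simp: marked_points_def vertex_of_def quotient_def)

lemma vertex_of_eq_iff:
  "c \<in> D \<Longrightarrow> c' \<in> D \<Longrightarrow> vertex_of TR gl c = vertex_of TR gl c' \<longleftrightarrow> (c, c') \<in> vrel TR gl"
  unfolding vertex_of_def using eq_equiv_class_iff[OF equiv_vrel] by blast

text \<open>The rotation is finite and acyclic, so turning around a marked point ends, namely at a
  corner whose side is a boundary segment.\<close>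

lemma exists_last_corner: "c \<in> D \<Longrightarrow> \<exists>d\<in>bsegs TR gl. (c, d) \<in> (rot_rel gl)\<^sup>*"
proof -
  have "rot_rel gl \<subseteq> D \<times> D"
    using glD(1) by (auto simp: rot_rel_iff)
  then have "finite (rot_rel gl)"
    using finite_D by (meson finite_SigmaI finite_subset)
  then have "wf ((rot_rel gl)\<inverse>)"
    using acyclic_rot by (rule finite_acyclic_wf_converse)
  then show "c \<in> D \<Longrightarrow> ?thesis"
  proof (induction c)
    case (less c)
    show ?case
    proof (cases "gl c = None")
      case True
      then have "c \<in> bsegs TR gl" using less.prems by (simp add: bsegs_def)
      then show ?thesis by blast
    next
      case False
      then have "(c, nx (mate c)) \<in> rot_rel gl" by (simp add: rot_rel_iff)
      then show ?thesis using less by (meson converse_iff converse_rtrancl_into_rtrancl mate_in_D nx_in_D)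
    qed
  qed
qed

text \<open>The rotation is a partial function undefined at \<open>d\<close>, so any zigzag between
  \<open>d\<close> and \<open>c\<close> shortens to a forward path from \<open>c\<close> to
  \<open>d\<close>: a forward step out of \<open>c\<close> must be the first step of the path
  already found.\<close>

lemma last_corner_unique:
  assumes "gl d = None" "(d, c) \<in> (rot_rel gl \<union> (rot_rel gl)\<inverse>)\<^sup>*"
  shows "(c, d) \<in> (rot_rel gl)\<^sup>*"
  using assms(2)
proof induction
  case (step c c')
  from step.hyps(2) show ?case
  proof
    assume R: "(c, c') \<in> rot_rel gl"
    then have "c \<noteq> d" using assms(1) by (auto simp: rot_rel_iff)
    with step.IH obtain c'' where "(c, c'') \<in> rot_rel gl" "(c'', d) \<in> (rot_rel gl)\<^sup>*"
      by (meson converse_rtranclE)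
    then show ?thesis using R by (simp add: rot_rel_iff)
  next
    assume "(c, c') \<in> (rot_rel gl)\<inverse>"
    then show ?thesis using step.IH by (meson converse_iff converse_rtrancl_into_rtrancl)
  qed
qed simp

text \<open>Every marked point has exactly one last corner, and there its outgoing boundary segment
  starts.\<close>

lemma card_marked_points: "card (marked_points TR gl) = card (bsegs TR gl)"
proof -
  have "inj_on (vertex_of TR gl) (bsegs TR gl)"
  proof (rule inj_onI)
    fix d d' assume d: "d \<in> bsegs TR gl" "d' \<in> bsegs TR gl" "vertex_of TR gl d = vertex_of TR gl d'"
    then have "(d, d') \<in> vrel TR gl" using vertex_of_eq_iff by (auto simp: bsegs_def)
    then have "(d', d) \<in> (rot_rel gl)\<^sup>*"
      using d(1) by (intro last_corner_unique) (auto simp: vrel_def bsegs_def)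
    then show "d = d'" using d(2)
      by (auto simp: bsegs_def rot_rel_iff elim: converse_rtranclE)
  qed
  moreover have "vertex_of TR gl ` bsegs TR gl = marked_points TR gl"
  proof -
    have "vertex_of TR gl c \<in> vertex_of TR gl ` bsegs TR gl" if c: "c \<in> D" for c
    proof -
      obtain d where d: "d \<in> bsegs TR gl" "(c, d) \<in> (rot_rel gl)\<^sup>*"
        using exists_last_corner[OF c] by blast
      then have "(c, d) \<in> vrel TR gl"
        using that rtrancl_mono[of "rot_rel gl" "rot_rel gl \<union> (rot_rel gl)\<inverse>"]
        by (auto simp: vrel_def bsegs_def)
      then show ?thesis using d that vertex_of_eq_iff[of c d] by (auto simp: bsegs_def)
    qed
    then show ?thesis by (auto simp: marked_points_eq bsegs_def)
  qed
  ultimately show ?thesis by (metis card_image)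
qed

subsection \<open>Boundary components\<close>

definition bdry :: "'t \<times> nat \<Rightarrow> ('t \<times> nat) set set" where
  "bdry c = brel TR gl `` {vertex_of TR gl c}"

definition bedges :: "(('t \<times> nat) set \<times> ('t \<times> nat) set) set" where
  "bedges = (\<lambda>d. (vertex_of TR gl d, vertex_of TR gl (nx d))) ` bsegs TR gl"

lemma brel_eq:
  "brel TR gl = (bedges \<union> bedges\<inverse>)\<^sup>* \<inter> (marked_points TR gl \<times> marked_points TR gl)"
proof -
  have "bedges = {(vertex_of TR gl (t,k), vertex_of TR gl (t,(k+1) mod 3)) | t k. (t,k) \<in> bsegs TR gl}"
    unfolding bedges_def by (force simp: nx_def bsegs_def)
  then show ?thesis by (simp only: brel_def Let_def)
qed

lemma equiv_brel: "equiv (marked_points TR gl) (brel TR gl)"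
  unfolding brel_eq by (rule equiv_rtrancl_sym_restrict)

lemma boundary_components_eq: "boundary_components TR gl = bdry ` D"
  by (auto simp: boundary_components_def bdry_def quotient_def marked_points_eq)

lemma bdry_eq_iff:
  "c \<in> D \<Longrightarrow> c' \<in> D \<Longrightarrow> bdry c = bdry c' \<longleftrightarrow> (vertex_of TR gl c, vertex_of TR gl c') \<in> brel TR gl"
  unfolding bdry_def using eq_equiv_class_iff[OF equiv_brel] by (auto simp: marked_points_eq)

lemma vertex_in_component_iff:
  assumes "B \<in> boundary_components TR gl" "c \<in> D"
  shows "vertex_of TR gl c \<in> B \<longleftrightarrow> bdry c = B"
proof -
  obtain c' where c': "c' \<in> D" "B = bdry c'" using assms by (auto simp: boundary_components_eq)
  then show ?thesis using bdry_eq_iff[OF c'(1) assms(2)] by (auto simp: bdry_def)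
qed

text \<open>Across an arc the marked point stays the same; at a boundary segment \<open>mate\<close>
  is the identity and \<open>nx\<close> moves to the other end of the segment.\<close>

lemma bdry_rotate: "bdry (nx (mate c)) = bdry c"
proof (cases "c \<in> D")
  case True
  then have D: "nx (mate c) \<in> D" by simp
  have "(vertex_of TR gl c, vertex_of TR gl (nx (mate c))) \<in> brel TR gl"
  proof (cases "gl c = None")
    case True
    then have "c \<in> bsegs TR gl" "mate c = c" using \<open>c \<in> D\<close> by (auto simp: bsegs_def mate_fixed_iff)
    then have "(vertex_of TR gl c, vertex_of TR gl (nx (mate c))) \<in> bedges"
      by (auto simp: bedges_def)
    then show ?thesis using \<open>c \<in> D\<close> D by (auto simp: brel_eq marked_points_eq)
  next
    case False
    then have "(c, nx (mate c)) \<in> rot_rel gl" by (simp add: rot_rel_iff)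
    then have "(c, nx (mate c)) \<in> vrel TR gl" using \<open>c \<in> D\<close> D by (auto simp: vrel_def)
    then have "vertex_of TR gl c = vertex_of TR gl (nx (mate c))"
      using vertex_of_eq_iff[OF \<open>c \<in> D\<close> D] by simp
    then show ?thesis using \<open>c \<in> D\<close> by (auto simp: brel_eq marked_points_eq)
  qed
  then show ?thesis using bdry_eq_iff[OF True D] by simp
next
  case False
  then show ?thesis using permutes_not_in[OF permutes_mate] by (simp add: nx_def)
qed

lemma bdry_mate: "bdry (mate d) = bdry (nx d)"
  using bdry_rotate[of "mate d"] by simp

section \<open>Boundary components as cycles of a permutation\<close>

abbreviation "rotation \<equiv> nx \<circ> mate"

lemma permutes_rotation: "rotation permutes D"
  using permutes_compose[OF permutes_mate permutes_nx] .

lemma orbit_rotation_next: "orbit rotation (nx (mate x)) = orbit rotation x"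
  using permutation_orbit_step[of rotation x] permutes_rotation finite_D
  by (auto simp: permutation_permutes)

lemma orbit_rotation_vertex:
  assumes "vertex_of TR gl x = vertex_of TR gl y" "x \<in> D" "y \<in> D"
  shows "orbit rotation x = orbit rotation y"
proof -
  have "(x, y) \<in> (rot_rel gl \<union> (rot_rel gl)\<inverse>)\<^sup>*"
    using assms(1) vertex_of_eq_iff[OF assms(2,3)] by (simp add: vrel_def)
  then show ?thesis
  proof induction
    case (step y z)
    from step.hyps(2) have "z = nx (mate y) \<or> y = nx (mate z)"
      unfolding Un_iff converse_iff rot_rel_iff by blast
    then show ?case using step.IH orbit_rotation_next[of y] orbit_rotation_next[of z] by metis
  qed simp
qed

lemma orbit_rotation_bedge:
  assumes e: "(vertex_of TR gl x, vertex_of TR gl y) \<in> bedges" and "x \<in> D" "y \<in> D"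
  shows "orbit rotation x = orbit rotation y"
proof -
  obtain d where d: "d \<in> D" "gl d = None" "vertex_of TR gl x = vertex_of TR gl d"
    "vertex_of TR gl y = vertex_of TR gl (nx d)"
    using e by (auto simp: bedges_def bsegs_def)
  have "orbit rotation x = orbit rotation d" "orbit rotation y = orbit rotation (nx d)"
    using d assms orbit_rotation_vertex nx_in_D by blast+
  moreover have "mate d = d" using d mate_fixed_iff by blast
  ultimately show ?thesis using orbit_rotation_next[of d] by metis
qed

text \<open>Where turning around a marked point stops, \<open>rotation\<close> steps along the
  boundary segment to the next marked point, so each of its cycles runs through all corners of one
  boundary component. This ties the number of components to the sign of
  \<open>rotation\<close>.\<close>

lemma orbit_rotation_eq_iff:
  assumes c: "c \<in> D" "c' \<in> D"
  shows "orbit rotation c = orbit rotation c' \<longleftrightarrow> bdry c = bdry c'"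
proof
  assume "orbit rotation c = orbit rotation c'"
  then have "c' \<in> orbit rotation c"
    using orbit_eq_iff_mem[OF finite_D permutes_rotation] by blast
  then show "bdry c = bdry c'"
    by induction (simp_all add: bdry_rotate)
next
  assume "bdry c = bdry c'"
  then have "(vertex_of TR gl c, vertex_of TR gl c') \<in> (bedges \<union> bedges\<inverse>)\<^sup>*"
    using bdry_eq_iff[OF c] by (simp add: brel_eq)
  \<comment> \<open>The chain passes through marked points, so the claim is made for all corners at
    the current one.\<close>
  then have "\<forall>y\<in>D. vertex_of TR gl c' = vertex_of TR gl y \<longrightarrow> orbit rotation c = orbit rotation y"
  proof induction
    case base
    then show ?case using orbit_rotation_vertex c by blast
  next
    case (step v w)
    have "v \<in> vertex_of TR gl ` D"
      using step.hyps(2) by (auto simp: bedges_def bsegs_def)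
    then obtain x where x: "x \<in> D" "v = vertex_of TR gl x" by blast
    show ?case
    proof (intro ballI impI)
      fix y assume y: "y \<in> D" "w = vertex_of TR gl y"
      have "orbit rotation x = orbit rotation y"
        using step.hyps(2) orbit_rotation_bedge[of x y] orbit_rotation_bedge[of y x] x y by auto
      then show "orbit rotation c = orbit rotation y" using step.IH x by blast
    qed
  qed
  then show "orbit rotation c = orbit rotation c'" using c by blast
qed

subsection \<open>Counting arcs\<close>

lemma card_orbits_nx: "card (orbit nx ` D) = card TR"
proof -
  have "orbit nx c = orbit nx c' \<longleftrightarrow> fst c = fst c'" if "c \<in> D" "c' \<in> D" for c c'
  proof -
    note mem = orbit_eq_iff_mem[OF finite_D permutes_nx]
    have "fst y = fst c" if "y \<in> orbit nx c" for y using that by induction auto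
    moreover have "c \<in> orbit nx c" "nx c \<in> orbit nx c" "nx (nx c) \<in> orbit nx c"
      using orbit.base[of nx c] orbit.step[of "nx c" nx c] orbit.step[of "nx (nx c)" nx c] by simp_all
    ultimately show ?thesis using same_triangle[OF that] unfolding mem by metis
  qed
  then have "card (orbit nx ` D) = card (fst ` D)"
    by (rule card_image_eq_of_fibres)
  also have "fst ` D = TR" by (auto simp: sides_def)
  finally show ?thesis .
qed

lemma arcs_eq: "arcs gl = arc_of gl ` {d \<in> D. gl d \<noteq> None}"
proof (intro set_eqI iffI)
  fix x assume "x \<in> arcs gl"
  then obtain d e where "x = {d, e}" and e: "gl d = Some e" unfolding arcs_def by blast
  then have "x = arc_of gl d" "d \<in> {d \<in> D. gl d \<noteq> None}" using glD(1)[OF e] by (simp_all add: arc_of_def)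
  then show "x \<in> arc_of gl ` {d \<in> D. gl d \<noteq> None}" by blast
next
  fix x assume "x \<in> arc_of gl ` {d \<in> D. gl d \<noteq> None}"
  then obtain d where d: "x = arc_of gl d" "gl d \<noteq> None" by blast
  then obtain e where e: "gl d = Some e" by blast
  then have "x = {d, e}" using d by (simp add: arc_of_def)
  then show "x \<in> arcs gl" unfolding arcs_def using e by blast
qed

lemma finite_arcs: "finite (arcs gl)"
  using finite_D by (simp add: arcs_eq)

lemma arc_of_eq: "gl d \<noteq> None \<Longrightarrow> arc_of gl d = {d, mate d}"
  by (auto simp: arc_of_def mate_def)

lemma card_orbits_mate: "card (orbit mate ` D) = card (arcs gl) + card (bsegs TR gl)"
proof -
  have orb: "orbit mate c = {c, mate c}" for c
  proof -
    have "y \<in> {c, mate c}" if "y \<in> orbit mate c" for y using that by induction auto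
    moreover have "mate c \<in> orbit mate c" "c \<in> orbit mate c"
      using orbit.base[of mate c] orbit.step[of "mate c" mate c] by simp_all
    ultimately show ?thesis by blast
  qed
  have "orbit mate ` D = arcs gl \<union> (\<lambda>d. {d}) ` bsegs TR gl"
  proof -
    have "orbit mate ` D = orbit mate ` ({d \<in> D. gl d \<noteq> None} \<union> bsegs TR gl)"
      by (rule arg_cong[where f = "image (orbit mate)"]) (auto simp: bsegs_def)
    moreover have "orbit mate ` {d \<in> D. gl d \<noteq> None} = arcs gl"
      unfolding arcs_eq by (rule image_cong) (simp_all add: orb arc_of_eq)
    moreover have "orbit mate ` bsegs TR gl = (\<lambda>d. {d}) ` bsegs TR gl"
      by (rule image_cong) (simp_all add: orb bsegs_def mate_fixed_iff[THEN iffD2])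
    ultimately show ?thesis by (simp only: image_Un)
  qed
  moreover have "arcs gl \<inter> (\<lambda>d. {d}) ` bsegs TR gl = {}"
  proof -
    have "{d, e} \<noteq> {d'}" if "gl d = Some e" for d e d' using glD(3)[OF that] by blast
    then show ?thesis unfolding arcs_def by blast
  qed
  moreover have "finite (bsegs TR gl)" using finite_D by (simp add: bsegs_def)
  ultimately show ?thesis
    using finite_arcs by (simp add: card_Un_disjoint card_image inj_on_def)
qed

text \<open>Double counting of sides: an arc consists of two of them, a boundary segment is
  one.\<close>

lemma card_sides: "3 * card TR = 2 * card (arcs gl) + card (bsegs TR gl)"
proof -
  let ?G = "{d \<in> D. gl d \<noteq> None}"
  have G: "?G = \<Union> (arcs gl)"
  proof (intro set_eqI iffI)
    fix x assume "x \<in> ?G"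
    then have "arc_of gl x \<in> arcs gl" "x \<in> arc_of gl x" unfolding arcs_eq arc_of_def by blast+
    then show "x \<in> \<Union> (arcs gl)" by blast
  next
    fix x assume "x \<in> \<Union> (arcs gl)"
    then obtain d e where "x \<in> {d, e}" and e: "gl d = Some e" unfolding arcs_def by blast
    then show "x \<in> ?G" using glD[OF e] by auto
  qed
  moreover have "2 * card (arcs gl) = card (\<Union> (arcs gl))"
  proof (rule card_partition)
    show "finite (\<Union> (arcs gl))" unfolding G[symmetric] using finite_D by simp
    fix c1 assume "c1 \<in> arcs gl"
    then obtain d e where 1: "c1 = {d, e}" and de: "gl d = Some e" unfolding arcs_def by blast
    show "card c1 = 2" using glD(3)[OF de] 1 by simp
    fix c2 assume "c2 \<in> arcs gl" and ne: "c1 \<noteq> c2"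
    then obtain d' e' where 2: "c2 = {d', e'}" and de': "gl d' = Some e'" unfolding arcs_def by blast
    show "c1 \<inter> c2 = {}"
      using ne de de' glD(4)[OF de] glD(4)[OF de'] unfolding 1 2 by (auto simp: insert_commute)
  qed (rule finite_arcs)
  moreover have "card D = card ?G + card (bsegs TR gl)"
  proof -
    have "card (?G \<union> bsegs TR gl) = card ?G + card (bsegs TR gl)"
      using finite_D by (intro card_Un_disjoint) (auto simp: bsegs_def)
    moreover have "?G \<union> bsegs TR gl = D" by (auto simp: bsegs_def)
    ultimately show ?thesis by (simp only:)
  qed
  ultimately show ?thesis by (simp add: card_D)
qed

text \<open>The rotation is the product of the even permutation \<open>nx\<close> and of one transposition per arc;
  comparing signs shows that the Euler characteristic and the number of boundary components have the
  same parity, so the truncating division in the definition of the genus is exact.\<close>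
lemma euler_parity: "even (card TR + card (arcs gl) + card (boundary_components TR gl))"
proof -
  have perm: "permutation nx" "permutation mate"
    using permutes_nx permutes_mate finite_D by (auto simp: permutation_permutes)
  have "card (orbit rotation ` D) = card (bdry ` D)"
    using orbit_rotation_eq_iff by (rule card_image_eq_of_fibres)
  then have "evenperm rotation \<longleftrightarrow> even (3 * card TR + card (boundary_components TR gl))"
    using evenperm_iff_orbits[OF finite_D permutes_rotation] by (simp add: card_D boundary_components_eq)
  moreover have "evenperm nx"
    using evenperm_iff_orbits[OF finite_D permutes_nx] by (simp add: card_D card_orbits_nx)
  moreover have "evenperm mate \<longleftrightarrow> even (card (arcs gl))"
    using evenperm_iff_orbits[OF finite_D permutes_mate] card_sides
    by (simp add: card_D card_orbits_mate)
  ultimately show ?thesis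
    using evenperm_comp[OF perm] by auto
qed

text \<open>Marked points and boundary segments cancel in the Euler characteristic. Since a spanning
  tree of the dual graph uses one arc less than there are triangles, this leaves one arc less than
  there are boundary components off the tree.\<close>

lemma genus_0_card_arcs:
  assumes "genus TR gl = 0"
  shows "card (arcs gl) + 2 = card TR + card (boundary_components TR gl)"
proof -
  have "(2 - int (card (boundary_components TR gl)) + int (card (arcs gl)) - int (card TR)) div 2 = 0"
    using assms by (simp add: genus_def euler_char_def card_marked_points algebra_simps)
  moreover have "even (2 - int (card (boundary_components TR gl)) + int (card (arcs gl)) - int (card TR))"
    using euler_parity by auto
  ultimately have "2 - int (card (boundary_components TR gl)) + int (card (arcs gl)) - int (card TR) = 0"
    by (metis dvd_div_eq_0_iff)
  then show ?thesis by linarith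
qed

section \<open>Spanning trees of the dual graph\<close>

text \<open>\<open>X\<close> holds the triangles reached and \<open>C\<close> the arcs crossed, as
  pairs of sides, so that \<open>\<Union>C\<close> is the set of tree sides. Each new triangle is
  attached through a single arc, which rules out cycles.\<close>

inductive dual_tree :: "'t set \<Rightarrow> ('t \<times> nat) set set \<Rightarrow> bool" where
  single: "t \<in> TR \<Longrightarrow> dual_tree {t} {}"
| grow: "dual_tree X C \<Longrightarrow> d \<in> D \<Longrightarrow> fst d \<notin> X \<Longrightarrow> gl d \<noteq> None \<Longrightarrow> fst (mate d) \<in> X
    \<Longrightarrow> dual_tree (insert (fst d) X) (insert {d, mate d} C)"

lemma dual_tree_sides:
  "dual_tree X C \<Longrightarrow> \<forall>d\<in>\<Union>C. fst d \<in> X \<and> mate d \<in> \<Union>C"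
  by (induction rule: dual_tree.induct) auto

lemma dual_tree_card:
  "dual_tree X C \<Longrightarrow> finite X \<and> X \<subseteq> TR \<and> X \<noteq> {} \<and> finite C \<and> C \<subseteq> arcs gl \<and> card X = card C + 1"
proof (induction rule: dual_tree.induct)
  case (single t)
  then show ?case by simp
next
  case (grow X C d)
  have "{d, mate d} \<notin> C" using dual_tree_sides[OF grow.hyps(1)] grow.hyps(3) by blast
  moreover have "{d, mate d} \<in> arcs gl"
    unfolding arcs_eq using grow.hyps arc_of_eq by blast
  moreover have "fst d \<in> TR" using grow.hyps(2) by (cases d) (simp add: mem_D)
  ultimately show ?case using grow.IH grow.hyps(3) by simp
qed

text \<open>A new triangle meets the earlier tree in one arc only, and its still free constant is
  determined by agreement across that arc.\<close>

lemma dual_tree_potential: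
  fixes h :: "'t \<times> nat \<Rightarrow> int"
  assumes "dual_tree X C"
  shows "\<exists>c. \<forall>d\<in>\<Union>C. h d + c (fst d) = h (mate d) + c (fst (mate d))"
  using assms
proof (induction rule: dual_tree.induct)
  case (single t)
  then show ?case by simp
next
  case (grow X C d)
  then obtain c where c: "\<forall>d\<in>\<Union>C. h d + c (fst d) = h (mate d) + c (fst (mate d))" by blast
  define c' where "c' = c(fst d := h (mate d) + c (fst (mate d)) - h d)"
  have same: "c' t = c t" if "t \<in> X" for t using that grow.hyps(3) by (auto simp: c'_def)
  have "h x + c' (fst x) = h (mate x) + c' (fst (mate x))" if x: "x \<in> \<Union>(insert {d, mate d} C)" for x
  proof (cases "x \<in> \<Union>C")
    case True
    then have "fst x \<in> X" "fst (mate x) \<in> X" using dual_tree_sides[OF grow.hyps(1)] by blast+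
    moreover have "h x + c (fst x) = h (mate x) + c (fst (mate x))" using True c by blast
    ultimately show ?thesis using same by simp
  next
    case False
    then have "x = d \<or> x = mate d" using x by blast
    moreover have "h d + c' (fst d) = h (mate d) + c' (fst (mate d))"
      using same[OF grow.hyps(5)] by (simp add: c'_def)
    ultimately show ?thesis by (elim disjE) simp_all
  qed
  then show ?case by blast
qed

text \<open>Peeling leaves off the tree: the two remaining sides of a leaf triangle already identify
  its three corners.\<close>
lemma dual_tree_constant:
  assumes "dual_tree X C"
    and mate: "\<And>d. f (mate d) = f (nx d)"
    and "\<And>d. d \<in> D \<Longrightarrow> fst d \<in> X \<Longrightarrow> d \<notin> \<Union>C \<Longrightarrow> f (nx d) = f d"
    and "d \<in> D" "fst d \<in> X"
  shows "f (nx d) = f d"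
  using assms(1,3-5)
proof (induction arbitrary: d rule: dual_tree.induct)
  case (single t)
  then show ?case by blast
next
  case (grow X C d e)
  note out = grow.prems(1)
  have C: "x \<notin> \<Union>C" if "fst x = fst d" for x
    using dual_tree_sides[OF grow.hyps(1)] grow.hyps(3) that by metis
  have "x \<notin> \<Union>(insert {d, mate d} C)" if "fst x = fst d" "x \<noteq> d" for x
    using C[OF that(1)] that grow.hyps(3,5) by auto
  moreover have "nx d \<noteq> d" "nx (nx d) \<noteq> d"
    using nx_neq[OF grow.hyps(2)] nx_nx_nx[of d] by metis+
  ultimately have "f (nx (nx d)) = f (nx d)" "f (nx (nx (nx d))) = f (nx (nx d))"
    using out[of "nx d"] out[of "nx (nx d)"] grow.hyps(2) by auto
  then have d: "f (nx d) = f d" by simp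
  \<comment> \<open>Equality at the leaf passes across its arc, so \<open>mate d\<close>, which is
    not a side of the smaller tree, satisfies the hypothesis of the induction.\<close>
  have md: "f (nx (mate d)) = f (mate d)"
    using mate[of d] mate[of "mate d"] d by simp
  have X: "f (nx x) = f x" if "x \<in> D" "fst x \<in> X" for x
  proof (rule grow.IH[OF _ that])
    fix y assume y: "y \<in> D" "fst y \<in> X" "y \<notin> \<Union>C"
    then show "f (nx y) = f y" using out[of y] d md by (cases "y \<in> {d, mate d}") auto
  qed
  have T: "f (nx x) = f x" if "x \<in> D" "fst x = fst d" for x
    using out[of x] d md C[OF that(2)] that by (cases "x \<in> {d, mate d}") auto
  show ?case using X T grow.prems(2,3) by blast
qed

text \<open>A tree is grown greedily: while a triangle is missing, connectedness of the dual graph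
  provides an arc that leaves \<open>X\<close>.\<close>

lemma dual_tree_exists: "\<exists>C. dual_tree TR C"
proof -
  have "\<exists>X C. dual_tree X C \<and> card X = Suc n" if "n < card TR" for n
    using that
  proof (induction n)
    case 0
    obtain t where "t \<in> TR" using TR_nonempty by blast
    then have "dual_tree {t} {}" by (rule dual_tree.single)
    moreover have "card {t} = Suc 0" by simp
    ultimately show ?case by blast
  next
    case (Suc n)
    then have "n < card TR" by simp
    with Suc.IH obtain X C where X: "dual_tree X C" "card X = Suc n" by blast
    then have fX: "finite X" "X \<subseteq> TR" "X \<noteq> {}" using dual_tree_card by blast+
    have "X \<noteq> TR" using X(2) Suc.prems by auto
    then obtain x y where xy: "x \<in> X" "y \<in> TR" "y \<notin> X" using fX by blast
    have "\<exists>s s'. s \<in> X \<and> s' \<notin> X \<and> (s, s') \<in> adj_rel gl"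
    proof (rule ccontr)
      assume *: "\<not> ?thesis"
      have "(x, y) \<in> (adj_rel gl)\<^sup>*" using xy fX connected by blast
      then have "y \<in> X"
      proof induction
        case base
        show ?case using xy(1) .
      next
        case (step s s')
        then show ?case using * by blast
      qed
      then show False using xy by blast
    qed
    then obtain s k s' k' where s: "s \<in> X" "s' \<notin> X" and g: "gl (s, k) = Some (s', k')"
      unfolding adj_rel_def by blast
    note g' = glD[OF g]
    have "dual_tree (insert (fst (s', k')) X) (insert {(s', k'), mate (s', k')} C)"
      by (rule dual_tree.grow[OF X(1)]) (use s g' in \<open>simp_all add: mate_def\<close>)
    moreover have "card (insert (fst (s', k')) X) = Suc (Suc n)"
      using X(2) s(2) fX(1) by simp
    ultimately show ?case by blast
  qed
  moreover have "0 < card TR" using TR_nonempty finite_TR by (simp add: card_gt_0_iff)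
  then have "card TR - 1 < card TR" "Suc (card TR - 1) = card TR" by simp_all
  ultimately obtain X C where X: "dual_tree X C" "card X = card TR" by metis
  then have "X \<subseteq> TR" using dual_tree_card by blast
  then have "X = TR" using X(2) card_subset_eq[OF finite_TR] by blast
  then show ?thesis using X by blast
qed

text \<open>The hypotheses make \<open>f\<close> constant on each triangle and compatible across
  arcs; connectedness of the dual graph does the rest.\<close>

lemma constant_on_corners:
  assumes mate: "\<And>d. f (mate d) = f (nx d)"
    and nx: "\<And>d. d \<in> D \<Longrightarrow> f (nx d) = f d"
    and c: "c \<in> D" "c' \<in> D"
  shows "f c = f c'"
proof -
  have tri: "f x = f y" if "x \<in> D" "y \<in> D" "fst x = fst y" for x y
    using same_triangle[OF that] nx[of x] nx[of "nx x"] that by auto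
  have "(fst c, fst c') \<in> (adj_rel gl)\<^sup>*"
    using c connected by (cases c; cases c') (auto simp: mem_D)
  then have "\<forall>x\<in>D. fst x = fst c' \<longrightarrow> f c = f x"
  proof induction
    case base
    then show ?case using tri c(1) by metis
  next
    case (step s s')
    obtain k k' where g: "gl (s, k) = Some (s', k')"
      using step.hyps(2) unfolding adj_rel_def by blast
    have "f c = f (s, k)" using step.IH glD(1)[OF g] by simp
    also have "\<dots> = f (nx (s, k))" using nx glD(1)[OF g] by simp
    also have "\<dots> = f (s', k')" using mate[of "(s, k)"] g by (simp add: mate_def)
    finally show ?case using tri glD(2)[OF g] by (metis fst_conv)
  qed
  then show ?thesis using c(2) by blast
qed

section \<open>Potentials and boundary sums\<close>

text \<open>\<open>mate\<close> reverses a side, so it exchanges the sides starting on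
  \<open>B\<close> with those ending on \<open>B\<close>.\<close>

lemma sum_mate_bdry:
  "(\<Sum>d\<in>{d \<in> D. bdry d = B}. f (mate d)) = (\<Sum>d\<in>{d \<in> D. bdry (nx d) = B}. f d)"
  by (rule sum.reindex_bij_witness[of _ mate mate]) (auto simp: bdry_mate bdry_rotate)

lemma sum_nx_bdry:
  "(\<Sum>d\<in>{d \<in> D. bdry (nx d) = B}. f (nx d)) = (\<Sum>d\<in>{d \<in> D. bdry d = B}. f d)"
  by (rule sum.reindex_bij_witness[of _ "nx \<circ> nx" nx]) auto

text \<open>The potential lives on sides, boundary segments included, so that a relation holds at
  every corner and sums along a boundary component telescope. The corner between the sides
  \<open>d\<close> and \<open>nx d\<close> is \<open>nx d\<close>.\<close>

definition has_potential :: "('t \<times> nat \<Rightarrow> int) \<Rightarrow> bool" where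
  "has_potential v \<longleftrightarrow> (\<exists>r. \<forall>d\<in>D. r (mate d) = r d \<and> r d - r (nx d) = v (nx d))"

lemma sum_bdry_potential_difference:
  fixes h :: "'t \<times> nat \<Rightarrow> int"
  assumes "\<And>d. d \<in> D \<Longrightarrow> h d - h (nx d) = v (nx d)"
  shows "(\<Sum>d\<in>{d \<in> D. bdry d = B}. v d) = (\<Sum>d\<in>{d \<in> D. bdry d = B}. h (mate d) - h d)"
proof -
  have "(\<Sum>d\<in>{d \<in> D. bdry d = B}. v d) = (\<Sum>d\<in>{d \<in> D. bdry (nx d) = B}. v (nx d))"
    by (rule sum_nx_bdry[symmetric])
  also have "\<dots> = (\<Sum>d\<in>{d \<in> D. bdry (nx d) = B}. h d - h (nx d))"
    by (rule sum.cong) (simp_all add: assms)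
  also have "\<dots> = (\<Sum>d\<in>{d \<in> D. bdry d = B}. h (mate d) - h d)"
    by (simp add: sum_subtractf sum_mate_bdry sum_nx_bdry)
  finally show ?thesis .
qed

lemma has_potential_imp_sums_zero:
  assumes "has_potential v"
  shows "(\<Sum>d\<in>{d \<in> D. bdry d = B}. v d) = 0"
proof -
  obtain r where r: "\<And>d. d \<in> D \<Longrightarrow> r (mate d) = r d" "\<And>d. d \<in> D \<Longrightarrow> r d - r (nx d) = v (nx d)"
    using assms unfolding has_potential_def by blast
  show ?thesis
    using sum_bdry_potential_difference[of r v B, OF r(2)] r(1) by simp
qed

text \<open>If the flow along \<open>d0\<close> were non-zero, the other arcs outside the tree would be too few to
  connect the boundary components, and the net flow out of one part would be \<open>g d0\<close> up to sign.\<close>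
lemma flow_off_dual_tree_zero:
  fixes g :: "'t \<times> nat \<Rightarrow> int"
  assumes genus: "genus TR gl = 0" and tree: "dual_tree TR C"
    and flow: "\<And>B. (\<Sum>d\<in>{d \<in> D. bdry d = B}. g d) = 0"
    and anti: "\<And>d. g (mate d) = - g d"
    and off: "\<And>d. d \<in> \<Union>C \<Longrightarrow> g d = 0"
    and d0: "d0 \<in> D"
  shows "g d0 = 0"
proof (rule ccontr)
  assume g0: "g d0 \<noteq> 0"
  have glued: "gl d \<noteq> None" if "g d \<noteq> 0" for d
    using that anti[of d] mate_fixed_iff[of d] by auto
  \<comment> \<open>The arcs off the tree other than that of \<open>d0\<close>; there are two fewer
    of them than boundary components.\<close>
  define N where "N = arcs gl - C - {{d0, mate d0}}"
  \<comment> \<open>Either side of the arc may be chosen: the endpoints only change order, and the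
    condition imposed on \<open>a\<close> is symmetric.\<close>
  define edge where "edge x = (bdry (SOME d. d \<in> x), bdry (nx (SOME d. d \<in> x)))" for x
  have arc0: "{d0, mate d0} \<in> arcs gl - C"
    using glued[OF g0] d0 off g0 arcs_eq arc_of_eq by blast
  have tc: "finite C" "C \<subseteq> arcs gl" "card TR = card C + 1" using dual_tree_card[OF tree] by blast+
  have "card N = card (arcs gl) - card C - 1"
    unfolding N_def using arc0 tc finite_arcs by (simp add: card_Diff_subset)
  moreover have "card (arcs gl - C) > 0" using arc0 finite_arcs card_gt_0_iff by blast
  then have "card (arcs gl) > card C" using tc finite_arcs by (simp add: card_Diff_subset)
  ultimately have "card N + 2 = card (boundary_components TR gl)"
    using genus_0_card_arcs[OF genus] tc(3) by linarith
  moreover have fN: "finite N" using finite_arcs by (simp add: N_def)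
  ultimately have "card (edge ` N) + 2 \<le> card (boundary_components TR gl)"
    using card_image_le[OF fN, of edge] by linarith
  then have "\<exists>a. (\<exists>x\<in>boundary_components TR gl. a x) \<and> (\<exists>x\<in>boundary_components TR gl. \<not> a x)
      \<and> (\<forall>(x, y)\<in>edge ` N. a x = a y)"
    using fN finite_D by (intro few_edges_disconnected) (simp_all add: boundary_components_eq)
  then obtain a where a: "\<exists>x\<in>boundary_components TR gl. a x" "\<exists>x\<in>boundary_components TR gl. \<not> a x"
    and aN: "\<forall>(x, y)\<in>edge ` N. a x = a y"
    by (elim exE conjE)
  \<comment> \<open>The two-colouring seen at corners: \<open>f d\<close> and
    \<open>f (nx d)\<close> are the colours at the two ends of side \<open>d\<close>.\<close>
  define f where "f d = a (bdry d)" for d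
  have fm: "f (mate d) = f (nx d)" for d by (simp add: f_def bdry_mate)
  have fmn: "f (nx (mate d)) = f d" for d by (simp add: f_def bdry_rotate)
  have fN: "f (nx d) = f d" if "gl d \<noteq> None" "d \<in> D" "d \<notin> \<Union>C" "d \<noteq> d0" "d \<noteq> mate d0" for d
  proof -
    have "{d, mate d} \<in> N"
      unfolding N_def arcs_eq using that arc_of_eq by blast
    then have "edge {d, mate d} \<in> edge ` N" by blast
    moreover have "(SOME x. x \<in> {d, mate d}) \<in> {d, mate d}" by (rule someI[of _ d]) simp
    ultimately have "f (nx d) = f d \<or> f (nx (mate d)) = f (mate d)"
      using aN unfolding edge_def f_def by (metis (mono_tags, lifting) case_prodD empty_iff insert_iff)
    then show ?thesis using fm fmn by metis
  qed
  \<comment> \<open>If \<open>d0\<close> did not join different colours, no side off the tree would,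
    and peeling the tree would make \<open>a\<close> constant on all components.\<close>
  have sep: "f (nx d0) \<noteq> f d0"
  proof
    assume eq: "f (nx d0) = f d0"
    then have "f (nx (mate d0)) = f (mate d0)" using fm fmn by simp
    with eq fN have "f (nx d) = f d" if "d \<in> D" "d \<notin> \<Union>C" for d
      using that mate_fixed_iff[of d] fm[of d] by metis
    then have "f (nx d) = f d" if "d \<in> D" for d
      using dual_tree_constant[OF tree fm _ that] that by (cases d) (auto simp: mem_D)
    then have "f c = f c'" if "c \<in> D" "c' \<in> D" for c c'
      using constant_on_corners[OF fm _ that] by blast
    then show False using a unfolding boundary_components_eq f_def by blast
  qed
  \<comment> \<open>The flow conditions are added up over the components selected by
    \<open>a\<close>.\<close>
  have "(\<Sum>d\<in>{d \<in> D. f d}. g d) = (\<Sum>B\<in>{B \<in> bdry ` D. a B}. \<Sum>d\<in>{d \<in> D. bdry d = B}. g d)"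
  proof -
    have "(\<Sum>B\<in>{B \<in> bdry ` D. a B}. sum g {d \<in> {d \<in> D. f d}. bdry d = B}) = sum g {d \<in> D. f d}"
      by (rule sum.group) (auto simp: finite_D f_def)
    moreover have "{d \<in> {d \<in> D. f d}. bdry d = B} = {d \<in> D. bdry d = B}" if "a B" for B
      using that by (auto simp: f_def)
    ultimately show ?thesis by simp
  qed
  then have zero: "(\<Sum>d\<in>{d \<in> D. f d}. g d) = 0" by (simp add: flow)
  \<comment> \<open>Sides with both ends in the selected part; they cancel against their
    mates.\<close>
  define I where "I = {d \<in> D. f d \<and> f (nx d)}"
  \<comment> \<open>The orientation of the arc of \<open>d0\<close> that starts in the selected
    part.\<close>
  define d1 where "d1 = (if f d0 then d0 else mate d0)"
  have "(\<Sum>d\<in>I. g d) = (\<Sum>d\<in>I. g (mate d))"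
    by (rule sum.reindex_bij_witness[of _ mate mate]) (auto simp: I_def fm fmn)
  then have "(\<Sum>d\<in>I. g d) = 0" by (simp add: anti sum_negf)
  \<comment> \<open>Any side other than \<open>d1\<close> that leaves the selected part lies on the
    tree, where \<open>g\<close> vanishes.\<close>
  moreover have "(\<Sum>d\<in>{d \<in> D. f d}. g d) = (\<Sum>d\<in>insert d1 I. g d)"
  proof (rule sum.mono_neutral_right)
    have "d1 \<in> D" "f d1" using d0 sep fm by (auto simp: d1_def)
    then show "insert d1 I \<subseteq> {d \<in> D. f d}" by (auto simp: I_def)
    show "\<forall>d\<in>{d \<in> D. f d} - insert d1 I. g d = 0"
    proof (rule ballI, rule ccontr)
      fix d assume d: "d \<in> {d \<in> D. f d} - insert d1 I" and gd: "g d \<noteq> 0"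
      then have "d \<in> D" "f d" "\<not> f (nx d)" "d \<noteq> d1" by (auto simp: I_def)
      then have "d = d0 \<or> d = mate d0" using fN[OF glued[OF gd]] off gd by blast
      then show False using \<open>f d\<close> \<open>\<not> f (nx d)\<close> \<open>d \<noteq> d1\<close> fm fmn by (auto simp: d1_def split: if_splits)
    qed
  qed (simp add: finite_D)
  moreover have "d1 \<notin> I" "finite I" using sep fm fmn finite_D by (auto simp: d1_def I_def)
  ultimately have "g d1 = 0" using zero by simp
  then show False using g0 anti by (auto simp: d1_def split: if_splits)
qed

lemma sums_zero_imp_has_potential:
  fixes v :: "'t \<times> nat \<Rightarrow> int"
  assumes genus: "genus TR gl = 0"
    and tri: "\<And>t. t \<in> TR \<Longrightarrow> v (t, 0) + v (t, 1) + v (t, 2) = 0"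
    and sums: "\<And>B. (\<Sum>d\<in>{d \<in> D. bdry d = B}. v d) = 0"
  shows "has_potential v"
proof -
  \<comment> \<open>A primitive of \<open>v\<close> on each triangle, normalised to 0 on side 0; it
    closes up because \<open>v\<close> sums to zero there.\<close>
  define h where "h d = (case d of (t, k) \<Rightarrow>
      if k = 0 then 0 else if k = 1 then - v (t, 1) else - v (t, 1) - v (t, 2))" for d :: "'t \<times> nat"
  have h: "h d - h (nx d) = v (nx d)" if "d \<in> D" for d
  proof -
    obtain t k where "d = (t, k)" "t \<in> TR" "k = 0 \<or> k = 1 \<or> k = 2"
      using \<open>d \<in> D\<close> by (cases d) (auto simp: sides_def)
    then show ?thesis using tri[of t] by (auto simp: nx_def mem_D h_def numeral_2_eq_2)
  qed
  obtain C where C: "dual_tree TR C" using dual_tree_exists by blast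
  obtain c where c: "\<forall>d\<in>\<Union>C. h d + c (fst d) = h (mate d) + c (fst (mate d))"
    using dual_tree_potential[OF C] by blast
  define r where "r d = h d + c (fst d)" for d
  have r: "r d - r (nx d) = v (nx d)" if "d \<in> D" for d
    using h[OF that] by (simp add: r_def)
  \<comment> \<open>The jump of \<open>r\<close> is antisymmetric, vanishes on the tree, and has the
    same sums over boundary components as \<open>v\<close>.\<close>
  have "r (mate d) - r d = 0" if "d \<in> D" for d
  proof (rule flow_off_dual_tree_zero[OF genus C _ _ _ that])
    show "(\<Sum>d\<in>{d \<in> D. bdry d = B}. r (mate d) - r d) = 0" for B
      using sum_bdry_potential_difference[of r v B, OF r] sums[of B] by simp
    show "r (mate d) - r d = 0" if "d \<in> \<Union>C" for d
      unfolding r_def using bspec[OF c that] by simp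
  qed simp
  then have "\<forall>d\<in>D. r (mate d) = r d \<and> r d - r (nx d) = v (nx d)" using r by simp
  then show ?thesis unfolding has_potential_def by blast
qed

section \<open>Cuts\<close>

definition corner_weight :: "('t \<Rightarrow> nat) \<Rightarrow> 't \<times> nat \<Rightarrow> int" where
  "corner_weight chi c = (if internal gl (fst c) \<and> snd c = chi (fst c) then 1 else 0)"

text \<open>An arrow \<open>d\<close> turns from side \<open>d\<close> to side \<open>nx d\<close>
  around the corner \<open>nx d\<close>, whence the shift between arrows and selected
  corners.\<close>

lemma cut_weight_eq:
  assumes "admissible_cut TR gl chi" "d \<in> D"
  shows "cut_weight gl chi d = corner_weight chi (nx d)"
proof (cases "internal gl (fst d)")
  case True
  have d: "fst d \<in> TR" "snd d < 3" using assms(2) mem_D[of "fst d" "snd d"] by simp_all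
  then have "chi (fst d) < 3" using assms(1) True by (simp add: admissible_cut_def)
  moreover have "k = (c + 2) mod 3 \<longleftrightarrow> (k + 1) mod 3 = c" if "k < 3" "c < 3" for k c :: nat
  proof -
    have "k = 0 \<or> k = 1 \<or> k = 2" "c = 0 \<or> c = 1 \<or> c = 2" using that by linarith+
    then show ?thesis by (elim disjE) simp_all
  qed
  ultimately have "snd d = (chi (fst d) + 2) mod 3 \<longleftrightarrow> (snd d + 1) mod 3 = chi (fst d)"
    using d(2) by blast
  moreover have "nx d = (fst d, (snd d + 1) mod 3)" using assms(2) by (simp only: nx_def if_True)
  ultimately show ?thesis
    unfolding cut_weight_def corner_weight_def by (simp only: fst_conv snd_conv)
qed (simp add: cut_weight_def corner_weight_def)

lemma corner_weight_triangle_sum: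
  assumes "admissible_cut TR gl chi" "t \<in> TR"
  shows "corner_weight chi (t, 0) + corner_weight chi (t, 1) + corner_weight chi (t, 2)
    = (if internal gl t then 1 else 0)"
proof (cases "internal gl t")
  case True
  then have "chi t < 3" using assms by (simp add: admissible_cut_def)
  then consider "chi t = 0" | "chi t = 1" | "chi t = 2" by linarith
  then show ?thesis by cases (simp_all add: corner_weight_def)
qed (simp add: corner_weight_def)

lemma card_cuts_on_component:
  assumes "admissible_cut TR gl chi" "B \<in> boundary_components TR gl"
  shows "int (card {t \<in> TR. internal gl t \<and> vertex_of TR gl (t, chi t) \<in> B})
    = (\<Sum>d\<in>{d \<in> D. bdry d = B}. corner_weight chi d)"
proof -
  let ?L = "{t \<in> TR. internal gl t \<and> vertex_of TR gl (t, chi t) \<in> B}"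
  let ?R = "{d \<in> D. bdry d = B} \<inter> {d. internal gl (fst d) \<and> snd d = chi (fst d)}"
  have D: "(t, chi t) \<in> D" if "t \<in> TR" "internal gl t" for t
    using that assms(1) by (auto simp: mem_D admissible_cut_def)
  have "?R = (\<lambda>t. (t, chi t)) ` ?L"
    using vertex_in_component_iff[OF assms(2)] D by (auto simp: mem_D image_iff)
  then have "card ?R = card ?L" by (simp add: card_image inj_on_def)
  moreover have "(\<Sum>d\<in>{d \<in> D. bdry d = B}. corner_weight chi d) = int (card ?R)"
    unfolding corner_weight_def using finite_D by (simp add: sum.If_cases)
  ultimately show ?thesis by simp
qed

section \<open>Gradings on arcs versus potentials on sides\<close>

lemma arrows_eq: "arrows TR gl = {d \<in> D. gl d \<noteq> None \<and> gl (nx d) \<noteq> None}"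
  by (auto simp: arrows_def glued_def mem_D nx_def)

lemma internal_iff:
  assumes "d \<in> D"
  shows "internal gl (fst d) \<longleftrightarrow> gl d \<noteq> None \<and> gl (nx d) \<noteq> None \<and> gl (nx (nx d)) \<noteq> None"
proof -
  obtain t k where d: "d = (t, k)" "t \<in> TR" "k = 0 \<or> k = 1 \<or> k = 2"
    using assms by (cases d) (auto simp: sides_def)
  then show ?thesis
    by (auto simp: internal_def glued_def nx_def mem_D numeral_2_eq_2)
qed

lemma arc_of_mate: "gl d \<noteq> None \<Longrightarrow> arc_of gl (mate d) = arc_of gl d"
proof -
  assume d: "gl d \<noteq> None"
  then have "gl (mate d) \<noteq> None" using mate_fixed_iff mate_mate by metis
  then show ?thesis using d by (simp add: arc_of_eq insert_commute)
qed

text \<open>Arrows constrain \<open>r\<close> only between arcs of a common triangle. In an internal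
  triangle these are all the sides; in any other the weights vanish, so \<open>r\<close> is constant
  on its arcs and extends to its boundary segments by that constant.\<close>

lemma graded_equiv_iff:
  assumes adm: "admissible_cut TR gl chi1" "admissible_cut TR gl chi2"
  shows "graded_equiv_id TR gl chi1 chi2
    \<longleftrightarrow> has_potential (\<lambda>c. corner_weight chi2 c - corner_weight chi1 c)" (is "_ \<longleftrightarrow> has_potential ?v")
proof -
  have arrow: "cut_weight gl chi2 d = cut_weight gl chi1 d + r (arr_src gl d) - r (arr_tgt gl d)
      \<longleftrightarrow> r (arc_of gl d) - r (arc_of gl (nx d)) = ?v (nx d)" if "d \<in> D" for d and r :: "_ \<Rightarrow> int"
  proof -
    have "arr_tgt gl d = arc_of gl (nx d)" using that by (simp add: arr_tgt_def nx_def)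
    then show ?thesis
      using cut_weight_eq[OF adm(1) that] cut_weight_eq[OF adm(2) that] by (auto simp: arr_src_def)
  qed
  show ?thesis
  proof
    assume "graded_equiv_id TR gl chi1 chi2"
    then obtain r :: "_ \<Rightarrow> int" where "\<forall>d\<in>arrows TR gl.
        cut_weight gl chi2 d = cut_weight gl chi1 d + r (arr_src gl d) - r (arr_tgt gl d)"
      unfolding graded_equiv_id_def by blast
    then have r: "r (arc_of gl d) - r (arc_of gl (nx d)) = ?v (nx d)"
      if "d \<in> D" "gl d \<noteq> None" "gl (nx d) \<noteq> None" for d
      using that arrow[OF that(1), of r] unfolding arrows_eq by blast
    define s where "s d = r (arc_of gl d)" for d
    \<comment> \<open>A boundary segment takes the value of an arc of its triangle; 0 occurs only if
      no side of the triangle is an arc.\<close>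
    define r' where "r' d = (if gl d \<noteq> None then s d else if gl (nx d) \<noteq> None then s (nx d)
        else if gl (nx (nx d)) \<noteq> None then s (nx (nx d)) else 0)" for d
    have s: "s d - s (nx d) = ?v (nx d)" if "d \<in> D" "gl d \<noteq> None" "gl (nx d) \<noteq> None" for d
      using r[OF that] by (simp add: s_def)
    have "r' (mate d) = r' d" if "d \<in> D" for d
    proof (cases "gl d = None")
      case True
      then have "mate d = d" by (simp add: mate_fixed_iff)
      then show ?thesis by simp
    next
      case False
      then have "gl (mate d) \<noteq> None" using mate_fixed_iff mate_mate by metis
      then show ?thesis using False by (simp add: r'_def s_def arc_of_mate)
    qed
    moreover have "r' d - r' (nx d) = ?v (nx d)" if d: "d \<in> D" for d
    proof (cases "internal gl (fst d)")
      case True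
      then have "gl d \<noteq> None" "gl (nx d) \<noteq> None" using internal_iff[OF d] by blast+
      then show ?thesis using s[OF d] by (simp add: r'_def)
    next
      case False
      then have v: "?v x = 0" if "fst x = fst d" for x using that by (simp add: corner_weight_def)
      \<comment> \<open>Whichever two sides of a non-internal triangle are arcs, an arrow of weight
        difference zero joins them, so the order of the cases in \<open>r'\<close> does not
        matter.\<close>
      have "s d = s (nx d)" if "gl d \<noteq> None" "gl (nx d) \<noteq> None"
        using s[OF d that] v[of "nx d"] by simp
      moreover have "s (nx d) = s (nx (nx d))" if "gl (nx d) \<noteq> None" "gl (nx (nx d)) \<noteq> None"
        using s[of "nx d"] that d v[of "nx (nx d)"] by simp
      moreover have "s (nx (nx d)) = s d" if "gl (nx (nx d)) \<noteq> None" "gl d \<noteq> None"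
        using s[of "nx (nx d)"] that d v[of d] by simp
      ultimately have "r' d = r' (nx d)"
        unfolding r'_def nx_nx_nx by presburger
      then show ?thesis using v[of "nx d"] by simp
    qed
    ultimately show "has_potential ?v" unfolding has_potential_def by blast
  next
    assume "has_potential ?v"
    then obtain r where r: "\<And>d. d \<in> D \<Longrightarrow> r (mate d) = r d" "\<And>d. d \<in> D \<Longrightarrow> r d - r (nx d) = ?v (nx d)"
      unfolding has_potential_def by blast
    \<comment> \<open>The choice of a side of the arc is immaterial since \<open>r\<close> agrees on
      mates.\<close>
    define r' where "r' x = r (SOME d. d \<in> x)" for x
    have r': "r' (arc_of gl d) = r d" if "d \<in> D" "gl d \<noteq> None" for d
    proof -
      have "(SOME x. x \<in> {d, mate d}) \<in> {d, mate d}" by (rule someI[of _ d]) simp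
      then show ?thesis using r(1)[OF that(1)] by (auto simp: r'_def arc_of_eq[OF that(2)])
    qed
    show "graded_equiv_id TR gl chi1 chi2"
      unfolding graded_equiv_id_def
    proof (intro exI[of _ r'] ballI)
      fix d assume "d \<in> arrows TR gl"
      then have d: "d \<in> D" "gl d \<noteq> None" "gl (nx d) \<noteq> None" by (auto simp: arrows_eq)
      then show "cut_weight gl chi2 d = cut_weight gl chi1 d + r' (arr_src gl d) - r' (arr_tgt gl d)"
        using arrow[OF d(1), of r'] r' r(2)[OF d(1)] by simp
    qed
  qed
qed

text \<open>\<open>B\<close> may range over everything, because the sum is empty unless
  \<open>B\<close> is a boundary component.\<close>

lemma equi_distributed_iff:
  assumes adm: "admissible_cut TR gl chi1" "admissible_cut TR gl chi2"
  shows "equi_distributed TR gl chi1 chi2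
    \<longleftrightarrow> (\<forall>B. (\<Sum>d\<in>{d \<in> D. bdry d = B}. corner_weight chi2 d - corner_weight chi1 d) = 0)"
proof -
  have "(\<Sum>d\<in>{d \<in> D. bdry d = B}. corner_weight chi2 d - corner_weight chi1 d) = 0"
    if "B \<notin> boundary_components TR gl" for B
  proof -
    have "{d \<in> D. bdry d = B} = {}" using that by (auto simp: boundary_components_eq)
    then show ?thesis by (simp only: sum.empty)
  qed
  moreover have "card {t \<in> TR. internal gl t \<and> vertex_of TR gl (t, chi1 t) \<in> B}
      = card {t \<in> TR. internal gl t \<and> vertex_of TR gl (t, chi2 t) \<in> B}
      \<longleftrightarrow> (\<Sum>d\<in>{d \<in> D. bdry d = B}. corner_weight chi2 d - corner_weight chi1 d) = 0"
    if "B \<in> boundary_components TR gl" for B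
    using card_cuts_on_component[OF adm(1) that] card_cuts_on_component[OF adm(2) that]
    unfolding sum_subtractf by linarith
  ultimately show ?thesis unfolding equi_distributed_def by blast
qed

end

theorem theorem3p12:
  fixes TR :: "'t set" and gl :: "'t \<times> nat \<Rightarrow> ('t \<times> nat) option"
    and chi1 chi2 :: "'t \<Rightarrow> nat"
  assumes "standing_assms TR gl"
    and "genus TR gl = 0"
    and "admissible_cut TR gl chi1"
    and "admissible_cut TR gl chi2"
  shows "graded_equiv_id TR gl chi1 chi2 \<longleftrightarrow> equi_distributed TR gl chi1 chi2"
proof -
  interpret triangulation TR gl
    by unfold_locales (use assms(1) in \<open>simp add: standing_assms_def\<close>)
  let ?v = "\<lambda>c. corner_weight chi2 c - corner_weight chi1 c"
  \<comment> \<open>Both cuts have total weight 1 on an internal triangle and 0 on any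
    other.\<close>
  have tri: "?v (t, 0) + ?v (t, 1) + ?v (t, 2) = 0" if "t \<in> TR" for t
    using corner_weight_triangle_sum[OF assms(3) that] corner_weight_triangle_sum[OF assms(4) that]
    by linarith
  have "has_potential ?v \<longleftrightarrow> (\<forall>B. (\<Sum>d\<in>{d \<in> D. bdry d = B}. ?v d) = 0)"
    using has_potential_imp_sums_zero[of ?v] sums_zero_imp_has_potential[of ?v, OF assms(2) tri] by blast
  then show ?thesis
    using graded_equiv_iff[OF assms(3,4)] equi_distributed_iff[OF assms(3,4)] by simp
qed

end
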